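(* For every fixed $k \ge 3$, any streaming algorithm for \textsc{Diameter} in the VA model that works on all graphs with vertex cover number at most $k$ and uses $p$ passes over the stream requires $\Omega(n/p)$ bits of memory on $n$-vertex graphs.
   Context: Graphs are finite, simple, undirected, unweighted. The vertex cover number is the minimum size of a vertex set meeting every edge. \textsc{Diameter}: compute $\max_{s,t} d(s,t)$ (shortest-path distance). In the Vertex Arrival (VA) streaming model, the vertices arrive one by one in an arbitrary fixed order, and each edge is revealed when the later of its two endpoints arrives (together with that vertex). A $p$-pass algorithm reads the stream $p$ times with unlimited computation; memory is measured in bits. "Requires $\Omega(f)$ bits" means there is a constant $c>0$ such that every such algorithm uses at least $c\cdot f$ bits on some $n$-vertex input of the class, for all sufficiently large $n$ and all $p$. *)

theory Defs
  imports Complex_Main "HOL-Library.Extended_Nat"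
begin

definition simple_graph :: "'a set \<Rightarrow> 'a set set \<Rightarrow> bool" where
  "simple_graph V E \<longleftrightarrow> finite V \<and> (\<forall>e\<in>E. e \<subseteq> V \<and> card e = 2)"

definition vertex_cover :: "'a set \<Rightarrow> 'a set set \<Rightarrow> 'a set \<Rightarrow> bool" where
  "vertex_cover V E C \<longleftrightarrow> C \<subseteq> V \<and> (\<forall>e\<in>E. C \<inter> e \<noteq> {})"

definition vertex_cover_number :: "'a set \<Rightarrow> 'a set set \<Rightarrow> nat" where
  "vertex_cover_number V E = (LEAST m. \<exists>C. vertex_cover V E C \<and> card C = m)"

definition walk :: "'a set \<Rightarrow> 'a set set \<Rightarrow> 'a \<Rightarrow> 'a list \<Rightarrow> 'a \<Rightarrow> bool" where
  "walk V E s w t \<longleftrightarrow> w \<noteq> [] \<and> hd w = s \<and> last w = t \<and> set w \<subseteq> V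
     \<and> successively (\<lambda>u v. {u, v} \<in> E) w"

(* The infimum of the empty set is \<infinity>, so vertices in different components are at
   distance \<infinity>, and a disconnected graph has diameter \<infinity>. *)

definition distance :: "'a set \<Rightarrow> 'a set set \<Rightarrow> 'a \<Rightarrow> 'a \<Rightarrow> enat" where
  "distance V E s t = (INF w\<in>{w. walk V E s w t}. enat (length w - 1))"

definition diameter :: "'a set \<Rightarrow> 'a set set \<Rightarrow> enat" where
  "diameter V E = (SUP s\<in>V. SUP t\<in>V. distance V E s t)"

(* A stream item is an arriving vertex together with its neighbours among the vertices
   that have arrived before it. *)

type_synonym va_item = "nat \<times> nat set"

definition va_stream :: "nat set set \<Rightarrow> nat list \<Rightarrow> va_item list" where
  "va_stream E xs =
     map (\<lambda>i. (xs ! i, {u \<in> set (take i xs). {u, xs ! i} \<in> E})) [0..<length xs]"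

definition va_input :: "nat \<Rightarrow> nat \<Rightarrow> nat set set \<Rightarrow> nat list \<Rightarrow> bool" where
  "va_input k n E xs \<longleftrightarrow> simple_graph {..<n} E \<and> vertex_cover_number {..<n} E \<le> k
     \<and> distinct xs \<and> set xs = {..<n}"

(* A deterministic streaming algorithm whose memory content is a string of bits.  Update
   and output are arbitrary functions (unlimited computation).  Besides the memory, all
   three components may depend on the number n of vertices, and an update may also depend
   on the index of the current pass and on the position within that pass, both counted
   from 0: these are provided free of charge and need not be stored. *)

record streaming_alg =
  initial_mem :: "nat \<Rightarrow> bool list"
  update_mem :: "nat \<Rightarrow> nat \<Rightarrow> nat \<Rightarrow> va_item \<Rightarrow> bool list \<Rightarrow> bool list"
  answer_of :: "nat \<Rightarrow> bool list \<Rightarrow> enat"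

(* Memory content after t items have been read, where the stream is read cyclically. *)

primrec mem_after :: "streaming_alg \<Rightarrow> va_item list \<Rightarrow> nat \<Rightarrow> bool list" where
  "mem_after A \<sigma> 0 = initial_mem A (length \<sigma>)"
| "mem_after A \<sigma> (Suc t) =
     update_mem A (length \<sigma>) (t div length \<sigma>) (t mod length \<sigma>)
       (\<sigma> ! (t mod length \<sigma>)) (mem_after A \<sigma> t)"

definition result :: "streaming_alg \<Rightarrow> nat \<Rightarrow> va_item list \<Rightarrow> enat" where
  "result A p \<sigma> = answer_of A (length \<sigma>) (mem_after A \<sigma> (p * length \<sigma>))"

definition bits_used :: "streaming_alg \<Rightarrow> nat \<Rightarrow> va_item list \<Rightarrow> nat" where
  "bits_used A p \<sigma> = Max ((\<lambda>t. length (mem_after A \<sigma> t)) ` {..p * length \<sigma>})"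

(* The number p n of passes may depend on the number n of vertices. *)

definition solves_diameter :: "nat \<Rightarrow> (nat \<Rightarrow> nat) \<Rightarrow> streaming_alg \<Rightarrow> bool" where
  "solves_diameter k p A \<longleftrightarrow>
     (\<forall>n E xs. va_input k n E xs \<longrightarrow> result A (p n) (va_stream E xs) = diameter {..<n} E)"

end

theory Submission
  imports Defs
begin

text \<open>
  Take a hub \<open>0\<close> adjacent to the leaves \<open>1, \<dots>, m\<close>, and let two further vertices
  \<open>a = m + 1\<close> and \<open>b = m + 2\<close> arrive last, with leaf neighbourhoods \<open>X\<close> and \<open>Y\<close>.
  The three vertices \<open>0, a, b\<close> cover all edges.  The diameter is at most 3 if \<open>X\<close> and \<open>Y\<close>
  intersect, and at least 4 (the distance from \<open>a\<close> to \<open>b\<close>) if they are disjoint.  Only the item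
  of \<open>b\<close> depends on \<open>Y\<close> and only that of \<open>a\<close> on \<open>X\<close>, so the memory contents around the item of
  \<open>b\<close> in each of the \<open>p\<close> passes form the transcript of a protocol for set disjointness.  The
  \<open>2 ^ m\<close> pairs of a set and its complement are a fooling set and thus have distinct
  transcripts, whereas a memory of \<open>s\<close> bits allows at most \<open>2 ^ (4 * s * p)\<close> transcripts.
\<close>

section \<open>Hub graphs and their diameters\<close>

definition hub_graph :: "nat \<Rightarrow> nat set \<Rightarrow> nat set \<Rightarrow> nat set set" where
  "hub_graph m X Y = (\<lambda>v. {0, v}) ` {1..m} \<union> (\<lambda>v. {m + 1, v}) ` X \<union> (\<lambda>v. {m + 2, v}) ` Y"

lemma edge_hub_graph_iff:
  "{u, v} \<in> hub_graph m X Y \<longleftrightarrow>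
     u = 0 \<and> v \<in> {1..m} \<or> v = 0 \<and> u \<in> {1..m}
     \<or> u = m + 1 \<and> v \<in> X \<or> v = m + 1 \<and> u \<in> X
     \<or> u = m + 2 \<and> v \<in> Y \<or> v = m + 2 \<and> u \<in> Y"
  unfolding hub_graph_def by (auto simp: image_iff doubleton_eq_iff)

lemma va_input_hub_graph:
  assumes "k \<ge> 3" "X \<subseteq> {1..m}" "Y \<subseteq> {1..m}"
  shows "va_input k (m + 3) (hub_graph m X Y) [0..<m + 3]"
proof -
  have "vertex_cover {..<m + 3} (hub_graph m X Y) {0, m + 1, m + 2}"
    by (auto simp: vertex_cover_def hub_graph_def)
  then have "vertex_cover_number {..<m + 3} (hub_graph m X Y) \<le> card {0, m + 1, m + 2}"
    unfolding vertex_cover_number_def by (blast intro: Least_le)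
  then have "vertex_cover_number {..<m + 3} (hub_graph m X Y) \<le> k"
    using assms(1) by simp
  moreover have "simple_graph {..<m + 3} (hub_graph m X Y)"
    using assms(2,3) by (fastforce simp: simple_graph_def hub_graph_def card_2_iff)
  ultimately show ?thesis
    by (auto simp: va_input_def)
qed

lemma distance_le_walk:
  assumes "walk V E s w t"
  shows "distance V E s t \<le> enat (length w - 1)"
  unfolding distance_def using assms by (auto intro: INF_lower)

lemma diameter_hub_graph_le:
  assumes "z \<in> X" "z \<in> Y" "X \<subseteq> {1..m}" "Y \<subseteq> {1..m}"
  shows "diameter {..<m + 3} (hub_graph m X Y) \<le> 3"
proof -
  let ?V = "{..<m + 3}" and ?E = "hub_graph m X Y"
  have z: "1 \<le> z" "z \<le> m"
    using assms by auto
  \<comment> \<open>The common leaf \<open>z\<close> joins \<open>a = m + 1\<close> and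
    \<open>b = m + 2\<close> directly. Two leaves meet at the hub \<open>0\<close>, and
    \<open>a\<close> or \<open>b\<close> reaches any leaf through \<open>z\<close> and then
    \<open>0\<close>. Repeated vertices are harmless, since walks need not be paths.\<close>
  have short: "\<exists>w \<in> {[s], [s, t], [s, 0, t], [s, z, t], [s, 0, z, t], [s, z, 0, t]}. walk ?V ?E s w t"
    if "s \<in> ?V" "t \<in> ?V" for s t
  proof -
    have cls: "u = 0 \<or> u \<in> {1..m} \<or> u = m + 1 \<or> u = m + 2" if "u \<in> ?V" for u
      using that by auto
    show ?thesis
      using cls[OF that(1)] cls[OF that(2)] z assms that
      by (elim disjE) (simp_all add: walk_def edge_hub_graph_iff)
  qed
  have "distance ?V ?E s t \<le> 3" if st: "s \<in> ?V" "t \<in> ?V" for s t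
  proof -
    obtain w where w: "walk ?V ?E s w t" "length w \<le> 4"
      using short[OF st] by fastforce
    have "enat (length w - 1) \<le> 3"
      using w(2) by (simp add: numeral_eq_enat)
    with distance_le_walk[OF w(1)] show ?thesis
      by (rule order_trans)
  qed
  then show ?thesis
    unfolding diameter_def by (intro SUP_least) auto
qed

text \<open>A potential that rises by at most one per edge bounds distances from below.\<close>

lemma potential_along_walk:
  fixes \<phi> :: "'a \<Rightarrow> nat"
  assumes "successively (\<lambda>u v. \<phi> v \<le> Suc (\<phi> u)) w" "w \<noteq> []"
  shows "\<phi> (last w) \<le> \<phi> (hd w) + (length w - 1)"
  using assms
proof (induction w)
  case (Cons x w)
  then show ?case
    by (cases w) auto
qed simp

lemma diameter_hub_graph_ge:
  assumes "X \<inter> Y = {}" "X \<subseteq> {1..m}" "Y \<subseteq> {1..m}"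
  shows "4 \<le> diameter {..<m + 3} (hub_graph m X Y)"
proof -
  let ?V = "{..<m + 3}" and ?E = "hub_graph m X Y"
  \<comment> \<open>If \<open>X\<close> and \<open>Y\<close> are nonempty, these are the distances
    from \<open>m + 1\<close>. Disjointness keeps every vertex of \<open>Y\<close> at level 3, so
    that \<open>m + 2\<close> can sit at level 4.\<close>
  define \<phi> :: "nat \<Rightarrow> nat" where
    "\<phi> v = (if v = m + 1 then 0 else if v \<in> X then 1 else if v = 0 then 2
             else if v = m + 2 then 4 else 3)" for v
  have step: "\<phi> v \<le> Suc (\<phi> u)" if "{u, v} \<in> ?E" for u v
    using that assms unfolding edge_hub_graph_iff \<phi>_def by auto
  have "4 \<le> enat (length w - 1)" if w: "walk ?V ?E (m + 1) w (m + 2)" for w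
  proof -
    have "successively (\<lambda>u v. \<phi> v \<le> Suc (\<phi> u)) w"
      using w step unfolding walk_def by (auto elim!: successively_mono)
    then have "\<phi> (m + 2) \<le> \<phi> (m + 1) + (length w - 1)"
      using potential_along_walk[of \<phi> w] w by (auto simp: walk_def)
    moreover have "\<phi> (m + 1) = 0" "\<phi> (m + 2) = 4"
      using assms by (auto simp: \<phi>_def)
    ultimately show ?thesis
      by (simp add: numeral_eq_enat)
  qed
  \<comment> \<open>If \<open>X\<close> or \<open>Y\<close> is empty there is no walk; the infimum
    is then infinite and the bound still holds.\<close>
  then have "4 \<le> distance ?V ?E (m + 1) (m + 2)"
    unfolding distance_def by (auto intro: INF_greatest)
  also have "\<dots> \<le> diameter ?V ?E"
    unfolding diameter_def by (intro SUP_upper2[of "m + 1"] SUP_upper2[of "m + 2"]) auto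
  finally show ?thesis .
qed

section \<open>Streams of hub graphs and pasting of runs\<close>

lemma length_va_stream [simp]: "length (va_stream E xs) = length xs"
  by (simp add: va_stream_def)

text \<open>\<open>Y\<close> enters only through edges at \<open>m + 2\<close>, and an item lists
  only earlier neighbours.\<close>

lemma hub_graph_stream_before_last:
  assumes "i < m + 2"
  shows "va_stream (hub_graph m X Y) [0..<m + 3] ! i = va_stream (hub_graph m X Y') [0..<m + 3] ! i"
proof -
  have "{u, i} \<in> hub_graph m X Y \<longleftrightarrow> {u, i} \<in> hub_graph m X Y'" if "u < i" for u
    using that assms by (auto simp: edge_hub_graph_iff)
  then show ?thesis
    using assms by (auto simp: va_stream_def simp del: upt_Suc)
qed

lemma hub_graph_stream_last:
  assumes "X \<subseteq> {1..m}" "X' \<subseteq> {1..m}"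
  shows "va_stream (hub_graph m X Y) [0..<m + 3] ! (m + 2)
    = va_stream (hub_graph m X' Y) [0..<m + 3] ! (m + 2)"
proof -
  have "{u, m + 2} \<in> hub_graph m X Y \<longleftrightarrow> {u, m + 2} \<in> hub_graph m X' Y" for u
    using assms by (auto simp: edge_hub_graph_iff)
  then show ?thesis
    by (auto simp: va_stream_def simp del: upt_Suc)
qed

lemma length_mem_after_le_bits_used:
  "t \<le> p * length \<sigma> \<Longrightarrow> length (mem_after A \<sigma> t) \<le> bits_used A p \<sigma>"
  unfolding bits_used_def by (intro Max_ge) auto

text \<open>The hybrid stream \<open>\<rho>\<close> follows \<open>\<sigma>\<close> up to the last
  item of a pass. There \<open>\<sigma>\<close> and \<open>\<tau>\<close> have equal memory, so
  \<open>\<rho>\<close> continues as \<open>\<tau>\<close> for one item, after which the two agree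
  again and the next pass starts as in \<open>\<sigma>\<close>.\<close>

lemma mem_after_cut_and_paste:
  assumes len: "length \<sigma> = Suc l" "length \<tau> = Suc l" "length \<rho> = Suc l"
    and before: "\<And>i. i < l \<Longrightarrow> \<rho> ! i = \<sigma> ! i" and last: "\<rho> ! l = \<tau> ! l"
    and agree_before: "\<And>j. j < p \<Longrightarrow> mem_after A \<sigma> (j * Suc l + l) = mem_after A \<tau> (j * Suc l + l)"
    and agree_after: "\<And>j. j < p \<Longrightarrow> mem_after A \<sigma> (Suc j * Suc l) = mem_after A \<tau> (Suc j * Suc l)"
  shows "j \<le> p \<Longrightarrow> mem_after A \<rho> (j * Suc l) = mem_after A \<sigma> (j * Suc l)"
proof (induction j)
  case 0
  then show ?case
    by (simp add: len)
next
  case (Suc j)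
  have dm: "(j * Suc l + i) div Suc l = j" "(j * Suc l + i) mod Suc l = i" if "i \<le> l" for i
  proof -
    have "(i + j * Suc l) div Suc l = j"
      using that by (subst div_mult_self1) auto
    then show "(j * Suc l + i) div Suc l = j"
      by (simp only: add.commute)
    have "(i + j * Suc l) mod Suc l = i"
      using that by (subst mod_mult_self1) auto
    then show "(j * Suc l + i) mod Suc l = i"
      by (simp only: add.commute)
  qed
  have step: "mem_after A \<xi> (Suc (j * Suc l + i))
      = update_mem A (Suc l) j i (\<xi> ! i) (mem_after A \<xi> (j * Suc l + i))"
    if "length \<xi> = Suc l" "i \<le> l" for \<xi> i
    using dm[OF that(2)] that(1) by (simp del: mult_Suc_right)
  have "mem_after A \<rho> (j * Suc l + i) = mem_after A \<sigma> (j * Suc l + i)" if "i \<le> l" for i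
    using that
  proof (induction i)
    case 0
    then show ?case
      using Suc by simp
  next
    case (Suc i)
    then show ?case
      using step[of \<rho> i] step[of \<sigma> i] len before[of i] by (simp del: mem_after.simps mult_Suc_right)
  qed
  then have "mem_after A \<rho> (j * Suc l + l) = mem_after A \<tau> (j * Suc l + l)"
    using agree_before Suc.prems by simp
  then have "mem_after A \<rho> (Suc (j * Suc l + l)) = mem_after A \<tau> (Suc (j * Suc l + l))"
    using step[of \<rho> l] step[of \<tau> l] len last by simp
  moreover have "Suc (j * Suc l + l) = Suc j * Suc l"
    by simp
  ultimately have "mem_after A \<rho> (Suc j * Suc l) = mem_after A \<tau> (Suc j * Suc l)"
    by metis
  then show ?case
    using agree_after Suc.prems by simp
qed

section \<open>Counting transcripts\<close>

lemma card_bool_lists_le: "card {w :: bool list. length w \<le> s} \<le> 2 ^ (2 * s)"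
proof -
  have "card {w :: bool list. length w \<le> s} = (\<Sum>i\<le>s. 2 ^ i)"
    using card_lists_length_le[of "UNIV :: bool set" s] by simp
  also have "\<dots> = 2 ^ Suc s - 1"
    by (induction s) auto
  \<comment> \<open>An exponent proportional to \<open>s\<close>, valid even for
    \<open>s = 0\<close>, avoids an additive term in the final bound.\<close>
  also have "\<dots> \<le> 2 ^ (2 * s)"
  proof (cases s)
    case (Suc r)
    have "(2 :: nat) ^ Suc s \<le> 2 ^ (2 * s)"
      by (rule power_increasing) (use Suc in auto)
    then show ?thesis
      by linarith
  qed simp
  finally show ?thesis .
qed

lemma hub_graph_memory_bound:
  assumes k: "k \<ge> 3" and solves: "solves_diameter k p A"
    and bits: "\<And>E xs. va_input k (m + 3) E xs \<Longrightarrow> bits_used A (p (m + 3)) (va_stream E xs) \<le> s"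
  shows "m \<le> 4 * s * p (m + 3)"
proof -
  define P where "P = p (m + 3)"
  define \<sigma> where "\<sigma> X Y = va_stream (hub_graph m X Y) [0..<m + 3]" for X Y
  define \<mu> where "\<mu> X t = mem_after A (\<sigma> X ({1..m} - X)) t" for X t
  \<comment> \<open>The instants just before and just after the last item of each pass, when a
    protocol would hand the memory over.\<close>
  define ts where "ts = map (\<lambda>j. j * Suc (m + 2) + (m + 2)) [0..<P]
    @ map (\<lambda>j. Suc j * Suc (m + 2)) [0..<P]"
  define B where "B = {w :: bool list. length w \<le> s}"
  have finB: "finite B"
    unfolding B_def using finite_lists_length_le[of "UNIV :: bool set" s] by simp
  have len [simp]: "length (\<sigma> X Y) = Suc (m + 2)" for X Y
    by (simp add: \<sigma>_def)
  have res: "result A P (\<sigma> X Y) = diameter {..<m + 3} (hub_graph m X Y)"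
    if "X \<subseteq> {1..m}" "Y \<subseteq> {1..m}" for X Y
    using solves va_input_hub_graph[OF k that] unfolding solves_diameter_def P_def \<sigma>_def by blast
  \<comment> \<open>A point \<open>z\<close> of \<open>X - X'\<close> makes the hybrid pair of
    \<open>X\<close> and \<open>{1..m} - X'\<close> intersect, yet equal transcripts force on it the
    answer for the disjoint pair of \<open>X\<close> and its complement. Exchanging the roles of
    \<open>X\<close> and \<open>X'\<close> gives equality.\<close>
  have cross: "X \<subseteq> X'"
    if X: "X \<subseteq> {1..m}" "X' \<subseteq> {1..m}" and eq: "map (\<mu> X) ts = map (\<mu> X') ts" for X X'
  proof (rule ccontr)
    assume "\<not> X \<subseteq> X'"
    then obtain z where z: "z \<in> X" "z \<in> {1..m} - X'"
      using X by blast
    have agree: "\<mu> X t = \<mu> X' t" if "t \<in> set ts" for t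
      using eq that by simp
    have "mem_after A (\<sigma> X ({1..m} - X')) (P * Suc (m + 2)) = \<mu> X (P * Suc (m + 2))"
      unfolding \<mu>_def
    proof (rule mem_after_cut_and_paste[where \<tau> = "\<sigma> X' ({1..m} - X')" and p = P])
      show "\<sigma> X ({1..m} - X') ! i = \<sigma> X ({1..m} - X) ! i" if "i < m + 2" for i
        unfolding \<sigma>_def using that by (rule hub_graph_stream_before_last)
      show "\<sigma> X ({1..m} - X') ! (m + 2) = \<sigma> X' ({1..m} - X') ! (m + 2)"
        unfolding \<sigma>_def using X by (rule hub_graph_stream_last)
    qed (use agree in \<open>auto simp: ts_def \<mu>_def simp del: mult_Suc mult_Suc_right mem_after.simps\<close>)
    then have "result A P (\<sigma> X ({1..m} - X')) = result A P (\<sigma> X ({1..m} - X))"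
      unfolding result_def \<mu>_def len by simp
    moreover have "result A P (\<sigma> X ({1..m} - X')) \<le> 3"
      using res diameter_hub_graph_le[OF z X(1)] X by auto
    moreover have "4 \<le> result A P (\<sigma> X ({1..m} - X))"
      using res diameter_hub_graph_ge[of X "{1..m} - X" m] X by auto
    ultimately have "(4 :: enat) \<le> 3"
      by (metis order_trans)
    then show False
      by simp
  qed
  have inj: "inj_on (\<lambda>X. map (\<mu> X) ts) (Pow {1..m})"
    by (rule inj_onI) (metis PowD cross subset_antisym)
  have times: "t \<le> P * Suc (m + 2)" if "t \<in> set ts" for t
  proof -
    have "j * Suc (m + 2) + (m + 2) \<le> P * Suc (m + 2) \<and> Suc j * Suc (m + 2) \<le> P * Suc (m + 2)"
      if "j < P" for j
      using mult_le_mono1[of "Suc j" P "Suc (m + 2)"] that by auto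
    then show ?thesis
      using that unfolding ts_def by (auto simp del: mult_Suc mult_Suc_right)
  qed
  have mem: "\<mu> X t \<in> B" if "X \<subseteq> {1..m}" "t \<in> set ts" for X t
  proof -
    have "length (\<mu> X t) \<le> bits_used A P (\<sigma> X ({1..m} - X))"
      unfolding \<mu>_def using times[OF that(2)] by (intro length_mem_after_le_bits_used) simp
    also have "\<dots> \<le> s"
      unfolding P_def \<sigma>_def using that(1) by (intro bits va_input_hub_graph[OF k]) auto
    finally show ?thesis
      by (simp add: B_def)
  qed
  have "2 ^ m = card (Pow {1..m})"
    by (simp add: card_Pow)
  \<comment> \<open>A transcript consists of two memory contents per pass.\<close>
  also have "\<dots> \<le> card {ws. set ws \<subseteq> B \<and> length ws = 2 * P}"
    by (rule card_inj_on_le[OF inj])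
      (use mem finB in \<open>auto simp: ts_def finite_lists_length_eq simp del: mult_Suc mult_Suc_right\<close>)
  also have "\<dots> = card B ^ (2 * P)"
    by (rule card_lists_length_eq[OF finB])
  also have "\<dots> \<le> (2 ^ (2 * s)) ^ (2 * P)"
    unfolding B_def by (intro power_mono card_bool_lists_le) simp
  also have "\<dots> = 2 ^ (4 * s * P)"
    by (simp flip: power_mult)
  finally show ?thesis
    by (simp add: P_def)
qed

theorem theorem17:
  fixes k :: nat
  assumes "k \<ge> 3"
  shows "\<exists>c::real. c > 0 \<and> (\<exists>N::nat. \<forall>(p :: nat \<Rightarrow> nat) (A :: streaming_alg).
           (\<forall>n. p n \<ge> 1) \<and> solves_diameter k p A \<longrightarrow>
           (\<forall>n\<ge>N. \<exists>E xs. va_input k n E xs \<and>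
              real (bits_used A (p n) (va_stream E xs)) \<ge> c * (real n / real (p n))))"
proof (intro exI[of _ "1/8 :: real"] conjI exI[of _ "7 :: nat"] allI impI)
  fix p :: "nat \<Rightarrow> nat" and A and n :: nat
  assume asm: "(\<forall>n. p n \<ge> 1) \<and> solves_diameter k p A" and n: "7 \<le> n"
  define b where "b = 1/8 * (real n / real (p n))"
  define s where "s = nat \<lfloor>b\<rfloor>"
  have p: "real (p n) \<ge> 1"
    using asm by (simp add: Suc_le_eq)
  obtain m where m: "n = m + 3"
    using n by (intro that[of "n - 3"]) simp
  have s: "real s \<le> b"
    unfolding s_def b_def by (simp add: of_nat_floor)
  show "\<exists>E xs. va_input k n E xs \<and>
      real (bits_used A (p n) (va_stream E xs)) \<ge> 1/8 * (real n / real (p n))"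
  proof (rule ccontr)
    assume none: "\<not> ?thesis"
    \<comment> \<open>A natural number below \<open>b\<close> is at most its floor
      \<open>s\<close>.\<close>
    have "bits_used A (p (m + 3)) (va_stream E xs) \<le> s" if "va_input k (m + 3) E xs" for E xs
      using none that unfolding m s_def b_def by (intro le_nat_floor) force
    then have "m \<le> 4 * s * p n"
      using hub_graph_memory_bound[of k p A m s] assms asm m by blast
    then have "real m \<le> 4 * real s * real (p n)"
      by (metis of_nat_le_iff of_nat_mult of_nat_numeral)
    also have "\<dots> \<le> 4 * b * real (p n)"
      using s p by simp
    also have "\<dots> = real n / 2"
      using p by (simp add: b_def)
    \<comment> \<open>The constant 1/8 against the factor 4 leaves \<open>n / 2\<close>. As
      \<open>m = n - 3\<close>, the inequality forces \<open>n \<le> 6\<close>, whence the threshold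
      7.\<close>
    finally show False
      using n m by simp
  qed
qed simp

end
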